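(* Let $n\ge 2$, $r_1,\ldots,r_n>0$, $\theta>0$, and $R=\sum_{i=1}^n r_i$. Let $\lambda_1,\ldots,\lambda_n$ be independent random variables with $\lambda_i\sim\mathrm{Gamma}(r_i,\theta)$, and suppose that, conditionally on $\lambda=(\lambda_1,\ldots,\lambda_n)$, the counts $X_1,\ldots,X_n$ are mutually independent with $X_i\mid\lambda_i\sim\mathrm{Poisson}(\lambda_i)$. Let $S=\sum_{i=1}^nX_i$. Then for every integer $m\ge 0$, the conditional distribution of $X_1$ given $S=m$ is Beta-Binomial: for every integer $k$ with $0\le k\le m$, $$\mathrm{Pr}(X_1=k\mid S=m)=\binom{m}{k}\frac{B(k+r_1,\;R+m-k-r_1)}{B(r_1,\;R-r_1)}.$$
   Context: $\mathrm{Gamma}(r,\theta)$ denotes the gamma distribution with shape $r>0$ and scale $\theta>0$, i.e. with density $\frac{1}{\Gamma(r)\theta^{r}}t^{r-1}e^{-t/\theta}$ on $(0,\infty)$. $\mathrm{Poisson}(\mu)$ denotes the Poisson distribution with mean $\mu$. $B(z_1,z_2)=\int_0^1t^{z_1-1}(1-t)^{z_2-1}\,dt$ is the Beta function. *)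

theory Defs
  imports "HOL-Probability.Probability"
begin

definition gamma_density :: "real \<Rightarrow> real \<Rightarrow> real \<Rightarrow> real" where
  "gamma_density r \<theta> t =
     (if t > 0 then t powr (r - 1) * exp (- t / \<theta>) / (Gamma r * \<theta> powr r) else 0)"

definition gamma_distributed :: "'a measure \<Rightarrow> ('a \<Rightarrow> real) \<Rightarrow> real \<Rightarrow> real \<Rightarrow> bool" where
  "gamma_distributed M Y r \<theta> \<longleftrightarrow> distributed M lborel Y (\<lambda>t. ennreal (gamma_density r \<theta> t))"

text \<open>The conditional probability of the event \<open>A\<close> given the sub-sigma-algebra \<open>F\<close>, that is, the
  conditional expectation of its indicator. As usual it is determined almost everywhere only.\<close>
definition prob_given :: "'a measure \<Rightarrow> 'a measure \<Rightarrow> 'a set \<Rightarrow> 'a \<Rightarrow> real" where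
  "prob_given M F A = real_cond_exp M F (indicator A)"

definition cond_indep_vars ::
  "'a measure \<Rightarrow> 'a measure \<Rightarrow> ('i \<Rightarrow> 'b measure) \<Rightarrow> ('i \<Rightarrow> 'a \<Rightarrow> 'b) \<Rightarrow> 'i set \<Rightarrow> bool" where
  "cond_indep_vars M F N X I \<longleftrightarrow>
     (\<forall>i\<in>I. X i \<in> measurable M (N i)) \<and>
     (\<forall>J\<subseteq>I. finite J \<longrightarrow> (\<forall>A. (\<forall>j\<in>J. A j \<in> sets (N j)) \<longrightarrow>
        (AE \<omega> in M. prob_given M F {\<omega>'\<in>space M. \<forall>j\<in>J. X j \<omega>' \<in> A j} \<omega> =
           (\<Prod>j\<in>J. prob_given M F {\<omega>'\<in>space M. X j \<omega>' \<in> A j} \<omega>))))"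

definition cond_distributed ::
  "'a measure \<Rightarrow> 'a measure \<Rightarrow> 'b measure \<Rightarrow> ('a \<Rightarrow> 'b) \<Rightarrow> ('a \<Rightarrow> 'b measure) \<Rightarrow> bool" where
  "cond_distributed M F N X K \<longleftrightarrow>
     X \<in> measurable M N \<and>
     (\<forall>A\<in>sets N. AE \<omega> in M. prob_given M F {\<omega>'\<in>space M. X \<omega>' \<in> A} \<omega> = measure (K \<omega>) A)"

definition generated_by :: "'a measure \<Rightarrow> 'i set \<Rightarrow> ('i \<Rightarrow> 'a \<Rightarrow> real) \<Rightarrow> 'a measure" where
  "generated_by M I Y =
     vimage_algebra (space M) (\<lambda>\<omega>. \<lambda>i\<in>I. Y i \<omega>) (\<Pi>\<^sub>M i\<in>I. (borel :: real measure))"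

text \<open>The library defines \<open>Beta\<close> through \<open>Gamma\<close>; on positive reals it is the Euler integral.\<close>
lemma Beta_real_eq_integral:
  fixes a b :: real
  assumes "a > 0" and "b > 0"
  shows "Beta a b = integral {0..1} (\<lambda>t. t powr (a - 1) * (1 - t) powr (b - 1))"
  using has_integral_Beta_real[OF assms] by (simp add: integral_unique)

lemma subalgebra_generated_by:
  assumes "\<And>i. i \<in> I \<Longrightarrow> Y i \<in> borel_measurable M"
  shows "subalgebra M (generated_by M I Y)"
proof -
  have "(\<lambda>\<omega>. \<lambda>i\<in>I. Y i \<omega>) \<in> measurable M (\<Pi>\<^sub>M i\<in>I. (borel :: real measure))"
    using assms by (intro measurable_restrict) auto
  then show ?thesis
    unfolding subalgebra_def generated_by_def by (simp add: sets_image_in_sets)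
qed

end

theory Submission
  imports Defs
begin

text \<open>Mixing a Poisson variable over \<open>Gamma(r, \<theta>)\<close> gives a negative binomial variable with
  parameters \<open>r\<close> and \<open>\<theta> / (1 + \<theta>)\<close>, and the mixed counts are unconditionally independent. By the
  Vandermonde identity for rising factorials, sums of independent negative binomials with a common
  \<open>\<theta>\<close> are again negative binomial, with the shapes added. Hence the conditional probability is a
  quotient of three negative binomial probabilities, in which \<open>\<theta>\<close> cancels.\<close>

section \<open>Gamma integrals\<close>

lemma gamma_density_measurable [measurable]: "gamma_density r \<theta> \<in> borel_measurable borel"
  unfolding gamma_density_def[abs_def] by measurable

lemma gamma_density_nonneg: "r > 0 \<Longrightarrow> gamma_density r \<theta> t \<ge> 0"
  by (simp add: gamma_density_def Gamma_real_nonneg)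

lemma integral_gamma_density:
  assumes r: "r > 0" and \<theta>: "\<theta> > 0"
  shows "(\<integral>t. gamma_density r \<theta> t \<partial>lborel) = 1"
proof -
  have G: "Gamma r > 0" using r by simp
  \<comment> \<open>The substitution t = \<theta> x produces Euler's integrand; the remaining
    1/\<theta> will cancel the Jacobian. At x = 0 both sides agree because
    \<open>0 powr (r - 1)\<close> is 0.\<close>
  have eq: "gamma_density r \<theta> (\<theta> * x) = indicator {0..} x * x powr (r - 1) / exp x * (1 / (Gamma r * \<theta>))"
    for x
  proof (cases "x > 0")
    case True
    have "\<theta> powr r = \<theta> powr (r - 1) * \<theta>"
      using \<theta> by (simp add: powr_diff)
    then show ?thesis
      using True \<theta> G
      by (simp add: gamma_density_def powr_mult exp_minus field_simps)
  next
    case False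
    then show ?thesis
      using \<theta> by (cases "x = 0") (auto simp: gamma_density_def mult_le_0_iff zero_less_mult_iff)
  qed
  \<comment> \<open>Working with the nonnegative integral makes a separate integrability proof
    unnecessary.\<close>
  have "(\<integral>\<^sup>+t. ennreal (gamma_density r \<theta> t) \<partial>lborel)
      = ennreal \<theta> * (\<integral>\<^sup>+x. ennreal (gamma_density r \<theta> (\<theta> * x)) \<partial>lborel)"
    using nn_integral_real_affine[of "\<lambda>t. ennreal (gamma_density r \<theta> t)" \<theta> 0] \<theta> by simp
  also have "\<dots> = ennreal \<theta> * (\<integral>\<^sup>+x. ennreal (indicator {0..} x * x powr (r - 1) / exp x) * ennreal (1 / (Gamma r * \<theta>)) \<partial>lborel)"
    unfolding eq using G \<theta> by (subst ennreal_mult''[symmetric]) auto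
  also have "\<dots> = ennreal \<theta> * (ennreal (Gamma r) * ennreal (1 / (Gamma r * \<theta>)))"
    by (subst nn_integral_multc) (simp_all add: Gamma_conv_nn_integral_real[OF r])
  also have "\<dots> = 1"
    using G \<theta> by (simp flip: ennreal_mult)
  finally show ?thesis
    by (subst integral_eq_nn_integral) (auto simp: gamma_density_nonneg r)
qed

section \<open>Negative binomial weights\<close>

text \<open>With p = \<theta> / (1 + \<theta>) the last factor is (1 - p) to the power r, and
  \<open>pochhammer r k / fact k\<close> is the binomial coefficient of r + k - 1 over k for a real
  shape r.\<close>

definition neg_binomial :: "real \<Rightarrow> real \<Rightarrow> nat \<Rightarrow> real" where
  "neg_binomial \<theta> r k =
     pochhammer r k / fact k * (\<theta> / (1 + \<theta>)) ^ k * (1 + \<theta>) powr (- r)"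

text \<open>Multiplying the gamma density by the Poisson weight only changes its parameters.\<close>
lemma integral_gamma_density_poisson:
  assumes r: "r > 0" and \<theta>: "\<theta> > 0"
  shows "(\<integral>t. gamma_density r \<theta> t * (t ^ k / fact k * exp (- t)) \<partial>lborel) = neg_binomial \<theta> r k"
proof -
  have G: "Gamma r > 0" using r by simp
  have G': "Gamma (r + k) = pochhammer r k * Gamma r"
    using r by (subst pochhammer_Gamma) (auto simp: Gamma_eq_zero_iff elim!: nonpos_Ints_cases)
  have p: "pochhammer r k > 0" using r by (rule pochhammer_pos)
  \<comment> \<open>The factor t^k raises the shape to r + k, and exp(-t) raises the rate from
    1/\<theta> to 1/\<theta> + 1, so the new scale is \<theta> / (1 + \<theta>). The weight is 1/k!
    times the quotient of the two normalizing constants.\<close>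
  have eq: "gamma_density r \<theta> t * (t ^ k / fact k * exp (- t))
      = neg_binomial \<theta> r k * gamma_density (r + k) (\<theta> / (1 + \<theta>)) t" for t
  proof (cases "t > 0")
    case True
    have 1: "exp (- (t / \<theta>)) * exp (- t) = exp (- (t * (1 + \<theta>) / \<theta>))"
      using \<theta> by (simp add: field_simps flip: exp_add)
    have 2: "t powr (r - 1) * t ^ k = t powr (r + k - 1)"
      using True by (simp add: powr_add[symmetric] powr_realpow[symmetric] algebra_simps)
    have 3: "(\<theta> / (1 + \<theta>)) powr (r + k) = (\<theta> / (1 + \<theta>)) ^ k * \<theta> powr r * (1 + \<theta>) powr (- r)"
      using \<theta> by (simp add: powr_add powr_divide powr_minus powr_realpow field_simps)
    have "gamma_density r \<theta> t * (t ^ k / fact k * exp (- t))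
        = (t powr (r - 1) * t ^ k) * (exp (- (t / \<theta>)) * exp (- t)) / (Gamma r * \<theta> powr r * fact k)"
      using True by (simp add: gamma_density_def)
    also have "\<dots> = neg_binomial \<theta> r k * gamma_density (r + k) (\<theta> / (1 + \<theta>)) t"
      unfolding 1 2 using True G \<theta> p
      by (simp add: gamma_density_def neg_binomial_def 3 G' field_simps)
    finally show ?thesis .
  qed (simp add: gamma_density_def)
  show ?thesis
    unfolding eq using r \<theta> by (simp add: integral_gamma_density)
qed

text \<open>The powers of \<theta> / (1 + \<theta>) and 1 + \<theta> combine to a factor independent
  of k, and 1/(k! (m-k)!) is a binomial coefficient over m!. What remains is
  \<open>pochhammer_binomial_sum\<close>.\<close>

lemma neg_binomial_convolution:
  "(\<Sum>k\<le>m. neg_binomial \<theta> a k * neg_binomial \<theta> b (m - k)) = neg_binomial \<theta> (a + b) m"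
proof -
  have "neg_binomial \<theta> a k * neg_binomial \<theta> b (m - k)
      = real (m choose k) * pochhammer a k * pochhammer b (m - k)
        * ((\<theta> / (1 + \<theta>)) ^ m * (1 + \<theta>) powr (- (a + b)) / fact m)" if "k \<le> m" for k
  proof -
    have "(\<theta> / (1 + \<theta>)) ^ m = (\<theta> / (1 + \<theta>)) ^ k * (\<theta> / (1 + \<theta>)) ^ (m - k)"
      using that by (simp flip: power_add)
    moreover have "(1 + \<theta>) powr (- (a + b)) = (1 + \<theta>) powr (- a) * (1 + \<theta>) powr (- b)"
      by (simp flip: powr_add)
    ultimately show ?thesis
      using that by (simp add: neg_binomial_def binomial_fact del: power_divide)
  qed
  then have "(\<Sum>k\<le>m. neg_binomial \<theta> a k * neg_binomial \<theta> b (m - k))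
      = (\<Sum>k\<le>m. real (m choose k) * pochhammer a k * pochhammer b (m - k)
        * ((\<theta> / (1 + \<theta>)) ^ m * (1 + \<theta>) powr (- (a + b)) / fact m))"
    by (intro sum.cong) auto
  also have "\<dots> = pochhammer (a + b) m * ((\<theta> / (1 + \<theta>)) ^ m * (1 + \<theta>) powr (- (a + b)) / fact m)"
    by (simp only: pochhammer_binomial_sum sum_distrib_right)
  finally show ?thesis by (simp add: neg_binomial_def)
qed

text \<open>All powers involving \<theta> cancel because the exponents k and m - k add up to m and
  the shapes a and b to a + b. Each remaining rising factorial is a quotient of Gamma values, and
  these regroup into Beta functions.\<close>

lemma neg_binomial_ratio:
  assumes a: "a > 0" and b: "b > 0" and \<theta>: "\<theta> > 0" and km: "k \<le> m"
  shows "neg_binomial \<theta> a k * neg_binomial \<theta> b (m - k) / neg_binomial \<theta> (a + b) m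
    = real (m choose k) * Beta (real k + a) (b + real m - real k) / Beta a b"
proof -
  have P: "Gamma (x + real j) = pochhammer x j * Gamma x" if "x > 0" for x :: real and j
    using that by (subst pochhammer_Gamma) (auto simp: Gamma_eq_zero_iff elim!: nonpos_Ints_cases)
  have pos: "Gamma a > 0" "Gamma b > 0" "Gamma (a + b) > 0" "pochhammer (a + b) m > 0"
    "pochhammer a k > 0" "pochhammer b (m - k) > 0"
    using a b by (auto intro: pochhammer_pos)
  have pw: "(\<theta> / (1 + \<theta>)) ^ m = (\<theta> / (1 + \<theta>)) ^ k * (\<theta> / (1 + \<theta>)) ^ (m - k)"
    using km by (simp flip: power_add)
  have pw2: "(1 + \<theta>) powr (- (a + b)) = (1 + \<theta>) powr (- a) * (1 + \<theta>) powr (- b)"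
    by (simp flip: powr_add)
  \<comment> \<open>Naming the powers makes them opaque nonzero atoms, which
    \<open>field_simps\<close> can cancel without expanding them.\<close>
  define u v c d where "u = (\<theta> / (1 + \<theta>)) ^ k" and "v = (\<theta> / (1 + \<theta>)) ^ (m - k)"
    and "c = (1 + \<theta>) powr (- a)" and "d = (1 + \<theta>) powr (- b)"
  have nz: "u > 0" "v > 0" "c > 0" "d > 0"
    using \<theta> by (auto simp: u_def v_def c_def d_def)
  have "neg_binomial \<theta> a k * neg_binomial \<theta> b (m - k) / neg_binomial \<theta> (a + b) m
      = real (m choose k) * (pochhammer a k * pochhammer b (m - k) / pochhammer (a + b) m)"
    using nz pos km
    unfolding neg_binomial_def pw pw2 u_def[symmetric] v_def[symmetric] c_def[symmetric] d_def[symmetric]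
    by (simp add: binomial_fact field_simps)
  also have "pochhammer a k * pochhammer b (m - k) / pochhammer (a + b) m
      = Beta (a + real k) (b + real (m - k)) / Beta a b"
  proof -
    have "a + real k + (b + real (m - k)) = a + b + real m"
      using km by (simp add: of_nat_diff)
    then have "Beta (a + real k) (b + real (m - k))
        = (pochhammer a k * Gamma a) * (pochhammer b (m - k) * Gamma b) / (pochhammer (a + b) m * Gamma (a + b))"
      using a b by (simp only: Beta_def P add_pos_pos)
    moreover have "Gamma a \<noteq> 0" "Gamma b \<noteq> 0" "Gamma (a + b) \<noteq> 0"
      using pos by auto
    ultimately show ?thesis
      using pos(4) by (simp add: Beta_def)
  qed
  finally show ?thesis
    using km by (simp add: of_nat_diff add_ac diff_add_eq add_diff_eq)
qed

section \<open>From conditional to unconditional independence\<close>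

text \<open>The conditional probabilities factor into functions of the independent variables \<open>lam i\<close>, so
  the mixed variables are unconditionally independent.\<close>
lemma (in prob_space) cond_indep_mixture:
  fixes lam :: "'i \<Rightarrow> 'a \<Rightarrow> real" and X :: "'i \<Rightarrow> 'a \<Rightarrow> 'b"
    and h :: "'i \<Rightarrow> 'b set \<Rightarrow> real \<Rightarrow> real"
  assumes indep: "indep_vars (\<lambda>_. borel) lam I"
    and cond_indep: "cond_indep_vars M (generated_by M I lam) N X I"
    and cond_distr: "\<And>i. i \<in> I \<Longrightarrow> cond_distributed M (generated_by M I lam) (N i) (X i) (K i)"
    and h_measurable: "\<And>i A. i \<in> I \<Longrightarrow> A \<in> sets (N i) \<Longrightarrow> h i A \<in> borel_measurable borel"
    and h: "\<And>i A. i \<in> I \<Longrightarrow> A \<in> sets (N i) \<Longrightarrow> AE \<omega> in M. measure (K i \<omega>) A = h i A (lam i \<omega>)"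
  shows "indep_vars N X I"
    and "\<And>i A. i \<in> I \<Longrightarrow> A \<in> sets (N i) \<Longrightarrow> \<P>(\<omega> in M. X i \<omega> \<in> A) = (\<integral>\<omega>. h i A (lam i \<omega>) \<partial>M)"
proof -
  let ?F = "generated_by M I lam"
  have lam_meas: "\<And>i. i \<in> I \<Longrightarrow> lam i \<in> borel_measurable M"
    using indep by (auto simp: indep_vars_def)
  interpret F: finite_measure_subalgebra M ?F
    by unfold_locales (rule subalgebra_generated_by[OF lam_meas])
  have X_meas: "\<And>i. i \<in> I \<Longrightarrow> X i \<in> measurable M (N i)"
    using cond_indep by (simp add: cond_indep_vars_def)
  have given_int: "integrable M (prob_given M ?F A)" "(\<integral>\<omega>. prob_given M ?F A \<omega> \<partial>M) = prob A"
    if "A \<in> events" for A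
  \<comment> \<open>Tower property: the conditional expectation of an indicator integrates to the
    probability of the event.\<close>
  proof -
    have "integrable M (indicator A :: 'a \<Rightarrow> real)"
      using that by (simp add: integrable_real_indicator emeasure_eq_measure)
    from F.real_cond_exp_int[OF this] that
    show "integrable M (prob_given M ?F A)" "(\<integral>\<omega>. prob_given M ?F A \<omega> \<partial>M) = prob A"
      by (simp_all add: prob_given_def)
  qed
  have ev: "{\<omega>\<in>space M. X i \<omega> \<in> A} \<in> events" if "i \<in> I" "A \<in> sets (N i)" for i A
    using measurable_sets[OF X_meas[OF that(1)] that(2)] by (simp add: vimage_def Int_def conj_commute)
  have given: "AE \<omega> in M. prob_given M ?F {\<omega>\<in>space M. X i \<omega> \<in> A} \<omega> = h i A (lam i \<omega>)"
    if "i \<in> I" "A \<in> sets (N i)" for i A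
  proof -
    have "AE \<omega> in M. prob_given M ?F {\<omega>\<in>space M. X i \<omega> \<in> A} \<omega> = measure (K i \<omega>) A"
      using cond_distr[OF that(1)] that(2) unfolding cond_distributed_def by blast
    with h[OF that] show ?thesis by eventually_elim simp
  qed
  have h_lam: "(\<lambda>\<omega>. h i A (lam i \<omega>)) \<in> borel_measurable M" if "i \<in> I" "A \<in> sets (N i)" for i A
    using measurable_compose[OF lam_meas[OF that(1)] h_measurable[OF that]] .
  \<comment> \<open>Integrability is inherited from the conditional probability, which agrees with
    this function almost everywhere.\<close>
  have h_int: "integrable M (\<lambda>\<omega>. h i A (lam i \<omega>))" if "i \<in> I" "A \<in> sets (N i)" for i A
    by (rule integrable_cong_AE_imp[OF given_int(1)[OF ev[OF that]] h_lam[OF that] given[OF that]])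
  show prob_X: "\<P>(\<omega> in M. X i \<omega> \<in> A) = (\<integral>\<omega>. h i A (lam i \<omega>) \<partial>M)" if "i \<in> I" "A \<in> sets (N i)" for i A
  proof -
    have "prob {\<omega>\<in>space M. X i \<omega> \<in> A} = (\<integral>\<omega>. prob_given M ?F {\<omega>\<in>space M. X i \<omega> \<in> A} \<omega> \<partial>M)"
      using given_int(2)[OF ev[OF that]] by simp
    also have "\<dots> = (\<integral>\<omega>. h i A (lam i \<omega>) \<partial>M)"
      using given_int(1)[OF ev[OF that]] given[OF that] h_lam[OF that]
      by (intro integral_cong_AE) auto
    finally show ?thesis .
  qed
  show "indep_vars N X I"
    unfolding indep_vars_def2
  proof (intro conjI ballI X_meas indep_setsI)
    fix i assume "i \<in> I"
    then show "{X i -` A \<inter> space M |A. A \<in> sets (N i)} \<subseteq> events"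
      using X_meas by (auto intro: measurable_sets)
  next
    fix B J assume J: "J \<noteq> {}" "J \<subseteq> I" "finite J"
      and B: "\<forall>j\<in>J. B j \<in> {X j -` A \<inter> space M |A. A \<in> sets (N j)}"
    from B obtain A where A: "\<And>j. j \<in> J \<Longrightarrow> A j \<in> sets (N j)"
      "\<And>j. j \<in> J \<Longrightarrow> B j = X j -` A j \<inter> space M"
      by (auto simp: Bex_def choice_iff dest!: bchoice)
    let ?E = "{\<omega>\<in>space M. \<forall>j\<in>J. X j \<omega> \<in> A j}"
    have B_eq: "B j = {\<omega>\<in>space M. X j \<omega> \<in> A j}" if "j \<in> J" for j
      using A(2)[OF that] by auto
    have Int_eq: "(\<Inter>j\<in>J. B j) = ?E"
      using J(1) B_eq by auto
    have E: "?E \<in> events"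
      using J A ev by (intro sets.sets_Collect_finite_All) auto
    have "AE \<omega> in M. prob_given M ?F ?E \<omega> = (\<Prod>j\<in>J. prob_given M ?F {\<omega>\<in>space M. X j \<omega> \<in> A j} \<omega>)"
      using cond_indep J A(1) unfolding cond_indep_vars_def by blast
    \<comment> \<open>The exceptional null sets of the finitely many indices in J are
      merged.\<close>
    moreover have "AE \<omega> in M. \<forall>j\<in>J. prob_given M ?F {\<omega>\<in>space M. X j \<omega> \<in> A j} \<omega> = h j (A j) (lam j \<omega>)"
      using given J A(1) by (intro AE_finite_allI) auto
    ultimately have AE: "AE \<omega> in M. prob_given M ?F ?E \<omega> = (\<Prod>j\<in>J. h j (A j) (lam j \<omega>))"
      by eventually_elim simp
    have "prob (\<Inter>j\<in>J. B j) = (\<integral>\<omega>. prob_given M ?F ?E \<omega> \<partial>M)"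
      unfolding Int_eq using given_int(2)[OF E] by simp
    also have "\<dots> = (\<integral>\<omega>. (\<Prod>j\<in>J. h j (A j) (lam j \<omega>)) \<partial>M)"
      using given_int(1)[OF E] AE J A(1)
      by (intro integral_cong_AE borel_measurable_prod h_lam) auto
    \<comment> \<open>Here the independence of the \<open>lam j\<close> turns the expectation of a
      product into the product of expectations.\<close>
    also have "\<dots> = (\<Prod>j\<in>J. \<integral>\<omega>. h j (A j) (lam j \<omega>) \<partial>M)"
    proof (rule indep_vars_lebesgue_integral)
      show "indep_vars (\<lambda>_. borel) (\<lambda>j \<omega>. h j (A j) (lam j \<omega>)) J"
        using J A(1) h_measurable
        by (intro indep_vars_compose2[OF indep_vars_subset[OF indep]]) auto
    qed (use J A(1) h_int in auto)
    also have "\<dots> = (\<Prod>j\<in>J. prob (B j))"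
      using J A(1) prob_X B_eq by (intro prod.cong) auto
    finally show "prob (\<Inter>j\<in>J. B j) = (\<Prod>j\<in>J. prob (B j))" .
  qed
qed

section \<open>Poisson counts with gamma rates\<close>

text \<open>Countable additivity over singletons. The series form makes measurability in the rate t
  evident.\<close>

lemma measure_poisson_pmf:
  assumes "t > 0"
  shows "measure (measure_pmf (poisson_pmf t)) A = (\<Sum>k. indicator A k * (t ^ k / fact k * exp (- t)))"
proof -
  have "(\<lambda>k. measure (measure_pmf (poisson_pmf t)) (A \<inter> {k}))
      sums measure (measure_pmf (poisson_pmf t)) (\<Union>k. A \<inter> {k})"
    by (intro measure_pmf.finite_measure_UNION) (auto simp: disjoint_family_on_def)
  moreover have "(\<Union>k. A \<inter> {k}) = A" by auto
  moreover have "measure (measure_pmf (poisson_pmf t)) (A \<inter> {k}) = indicator A k * (t ^ k / fact k * exp (- t))"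
    for k using assms by (cases "k \<in> A") (auto simp: measure_pmf_single)
  ultimately show ?thesis by (simp add: sums_iff)
qed

text \<open>The density vanishes on the nonpositive reals. This allows the Poisson mass formula,
  stated for positive rates, to be used almost everywhere.\<close>

lemma gamma_distributed_pos:
  assumes "gamma_distributed M Y r \<theta>"
  shows "AE \<omega> in M. Y \<omega> > 0"
proof -
  have D: "distributed M lborel Y (\<lambda>t. ennreal (gamma_density r \<theta> t))"
    using assms by (simp add: gamma_distributed_def)
  have [measurable]: "Y \<in> borel_measurable M"
    using distributed_measurable[OF D] by simp
  have "emeasure M (Y -` {..0} \<inter> space M) = (\<integral>\<^sup>+t. ennreal (gamma_density r \<theta> t) * indicator {..0} t \<partial>lborel)"
    by (rule distributed_emeasure[OF D]) simp
  also have "\<dots> = 0"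
    by (intro nn_integral_zero' AE_I2) (auto simp: gamma_density_def split: split_indicator)
  finally show ?thesis
    by (intro AE_I[where N="Y -` {..0} \<inter> space M"]) auto
qed

lemma (in prob_space) gamma_poisson_mixture:
  fixes lam :: "'i \<Rightarrow> 'a \<Rightarrow> real" and X :: "'i \<Rightarrow> 'a \<Rightarrow> nat"
  assumes r: "\<And>i. i \<in> I \<Longrightarrow> r i > 0" and \<theta>: "\<theta> > 0"
    and indep: "indep_vars (\<lambda>_. borel) lam I"
    and gamma: "\<And>i. i \<in> I \<Longrightarrow> gamma_distributed M (lam i) (r i) \<theta>"
    and cond_indep: "cond_indep_vars M (generated_by M I lam) (\<lambda>_. count_space UNIV) X I"
    and cond_distr: "\<And>i. i \<in> I \<Longrightarrow> cond_distributed M (generated_by M I lam) (count_space UNIV) (X i)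
             (\<lambda>\<omega>. measure_pmf (poisson_pmf (lam i \<omega>)))"
  shows "indep_vars (\<lambda>_. count_space UNIV) X I"
    and "\<And>i k. i \<in> I \<Longrightarrow> \<P>(\<omega> in M. X i \<omega> = k) = neg_binomial \<theta> (r i) k"
proof -
  \<comment> \<open>A version of the Poisson probabilities that is measurable on the whole line;
    agreement with \<open>poisson_pmf\<close> is needed only at the almost surely positive values of
    \<open>lam i\<close>.\<close>
  define h :: "nat set \<Rightarrow> real \<Rightarrow> real"
    where "h A t = (\<Sum>k. indicator A k * (t ^ k / fact k * exp (- t)))" for A t
  have h_meas: "h A \<in> borel_measurable borel" for A
    unfolding h_def[abs_def] by measurable
  have h_eq: "AE \<omega> in M. measure (measure_pmf (poisson_pmf (lam i \<omega>))) A = h A (lam i \<omega>)"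
    if "i \<in> I" for i A
    using gamma_distributed_pos[OF gamma[OF that]]
    by eventually_elim (simp add: h_def measure_poisson_pmf)
  show "indep_vars (\<lambda>_. count_space UNIV) X I"
    by (rule cond_indep_mixture(1)[OF indep cond_indep cond_distr h_meas h_eq])
  fix i k assume i: "i \<in> I"
  have h_sing: "h {k} t = t ^ k / fact k * exp (- t)" for t
  proof -
    have "(\<Sum>j. indicator {k} j * (t ^ j / fact j * exp (- t))) = (\<Sum>j\<in>{k}. indicator {k} j * (t ^ j / fact j * exp (- t)))"
      by (rule suminf_finite) auto
    then show ?thesis by (simp add: h_def)
  qed
  have "\<P>(\<omega> in M. X i \<omega> = k) = (\<integral>\<omega>. h {k} (lam i \<omega>) \<partial>M)"
    using cond_indep_mixture(2)[OF indep cond_indep cond_distr h_meas h_eq i, of "{k}"] by simp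
  also have "\<dots> = (\<integral>t. gamma_density (r i) \<theta> t * h {k} t \<partial>lborel)"
    using gamma[OF i] unfolding gamma_distributed_def
    by (intro distributed_integral[symmetric]) (auto simp: h_meas gamma_density_nonneg r i)
  also have "\<dots> = neg_binomial \<theta> (r i) k"
    unfolding h_sing using r[OF i] \<theta> by (rule integral_gamma_density_poisson)
  finally show "\<P>(\<omega> in M. X i \<omega> = k) = neg_binomial \<theta> (r i) k" .
qed

section \<open>Sums of independent counts\<close>

lemma (in prob_space) indep_vars_prob_sum_nat:
  fixes X :: "'i \<Rightarrow> 'a \<Rightarrow> nat"
  assumes "finite J" "i \<notin> J" and indep: "indep_vars (\<lambda>_. count_space UNIV) X (insert i J)"
  shows "\<P>(\<omega> in M. X i \<omega> = k \<and> (\<Sum>j\<in>J. X j \<omega>) = l)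
    = \<P>(\<omega> in M. X i \<omega> = k) * \<P>(\<omega> in M. (\<Sum>j\<in>J. X j \<omega>) = l)"
proof -
  \<comment> \<open>The counts are embedded in the reals to apply \<open>indep_vars_sum\<close>; the
    singletons \<open>{real k}\<close> and \<open>{real l}\<close> recover the original
    events.\<close>
  have "indep_vars (\<lambda>_. borel) (\<lambda>j \<omega>. real (X j \<omega>)) (insert i J)"
    by (rule indep_vars_compose2[OF indep]) simp
  then have "indep_var borel (\<lambda>\<omega>. real (X i \<omega>)) borel (\<lambda>\<omega>. \<Sum>j\<in>J. real (X j \<omega>))"
    using assms by (intro indep_vars_sum)
  from indep_varD[OF this, of "{real k}" "{real l}"] show ?thesis
    by (simp add: vimage_def Int_def conj_ac flip: of_nat_sum)
qed

lemma (in prob_space) sum_neg_binomial: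
  fixes X :: "'i \<Rightarrow> 'a \<Rightarrow> nat"
  assumes \<theta>: "\<theta> > 0"
  shows "finite J \<Longrightarrow> indep_vars (\<lambda>_. count_space UNIV) X J \<Longrightarrow>
    (\<And>i k. i \<in> J \<Longrightarrow> \<P>(\<omega> in M. X i \<omega> = k) = neg_binomial \<theta> (r i) k) \<Longrightarrow>
    \<P>(\<omega> in M. (\<Sum>i\<in>J. X i \<omega>) = m) = neg_binomial \<theta> (\<Sum>i\<in>J. r i) m"
proof (induction J arbitrary: m rule: finite_induct)
  case empty
  \<comment> \<open>Shape 0 gives the point mass at 0: \<open>pochhammer 0 m\<close> vanishes for m
    > 0, and \<open>(1 + \<theta>) powr 0\<close> is 1.\<close>
  show ?case
    using \<theta> by (cases m) (simp_all add: neg_binomial_def prob_space pochhammer_rec)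
next
  case (insert i J)
  note indep = insert.prems(1)
  have meas: "X j \<in> measurable M (count_space UNIV)" if "j \<in> insert i J" for j
    using indep that unfolding indep_vars_def by blast
  have [measurable]: "X i \<in> measurable M (count_space UNIV)"
    "(\<lambda>\<omega>. \<Sum>j\<in>J. X j \<omega>) \<in> measurable M (count_space UNIV)"
    using meas by (auto intro!: measurable_sum_nat)
  let ?E = "\<lambda>k. {\<omega>\<in>space M. X i \<omega> = k \<and> (\<Sum>j\<in>J. X j \<omega>) = m - k}"
  \<comment> \<open>The event is split by the value k of \<open>X i\<close>. The bound k \<le> m
    keeps the natural-number subtraction m - k from truncating.\<close>
  have "{\<omega>\<in>space M. (\<Sum>j\<in>insert i J. X j \<omega>) = m} = (\<Union>k\<le>m. ?E k)"
    using insert.hyps by auto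
  then have "\<P>(\<omega> in M. (\<Sum>j\<in>insert i J. X j \<omega>) = m) = (\<Sum>k\<le>m. prob (?E k))"
    by (simp only:) (intro finite_measure_finite_Union, auto simp: disjoint_family_on_def)
  also have "\<dots> = (\<Sum>k\<le>m. neg_binomial \<theta> (r i) k * neg_binomial \<theta> (\<Sum>j\<in>J. r j) (m - k))"
    using insert indep_vars_subset[OF indep]
    by (intro sum.cong refl) (simp add: indep_vars_prob_sum_nat subset_insertI)
  also have "\<dots> = neg_binomial \<theta> (\<Sum>j\<in>insert i J. r j) m"
    using insert.hyps by (simp add: neg_binomial_convolution)
  finally show ?case .
qed

section \<open>The Beta-binomial law as a quotient\<close>

theorem mainTheorem4:
  fixes M :: "'a measure"
    and n :: nat
    and r :: "nat \<Rightarrow> real"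
    and \<theta> R :: real
    and lam :: "nat \<Rightarrow> 'a \<Rightarrow> real"
    and X :: "nat \<Rightarrow> 'a \<Rightarrow> nat"
    and S :: "'a \<Rightarrow> nat"
    and m k :: nat
  assumes "prob_space M"
    and "n \<ge> 2"
    and "\<And>i. i \<in> {1..n} \<Longrightarrow> r i > 0"
    and "\<theta> > 0"
    and "R = (\<Sum>i=1..n. r i)"
    and "prob_space.indep_vars M (\<lambda>_. borel) lam {1..n}"
    and "\<And>i. i \<in> {1..n} \<Longrightarrow> gamma_distributed M (lam i) (r i) \<theta>"
    and "cond_indep_vars M (generated_by M {1..n} lam) (\<lambda>_. count_space UNIV) X {1..n}"
    and "\<And>i. i \<in> {1..n} \<Longrightarrow>
           cond_distributed M (generated_by M {1..n} lam) (count_space UNIV) (X i)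
             (\<lambda>\<omega>. measure_pmf (poisson_pmf (lam i \<omega>)))"
    and "\<And>\<omega>. S \<omega> = (\<Sum>i=1..n. X i \<omega>)"
    and "k \<le> m"
  shows "\<P>(\<omega> in M. X 1 \<omega> = k \<bar> S \<omega> = m) =
           real (m choose k) * Beta (real k + r 1) (R + real m - real k - r 1) / Beta (r 1) (R - r 1)"
proof -
  interpret prob_space M by fact
  note mix = gamma_poisson_mixture[OF assms(3,4,6,7,8,9)]
  have indep: "indep_vars (\<lambda>_. count_space UNIV) X {1..n}"
    by (rule mix(1))
  have prob_X: "\<P>(\<omega> in M. X i \<omega> = j) = neg_binomial \<theta> (r i) j" if "i \<in> {1..n}" for i j
    using that by (intro mix(2))
  have split: "{1..n} = insert 1 {2..n}"
    using \<open>n \<ge> 2\<close> by auto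
  have R: "R - r 1 = (\<Sum>i=2..n. r i)"
    unfolding assms(5) split by simp
  \<comment> \<open>Since n \<ge> 2 the tail sum is nonempty, so the second Beta parameter is
    positive.\<close>
  have R_pos: "R - r 1 > 0"
    unfolding R using assms(2,3) by (intro sum_pos) auto
  have tail: "\<P>(\<omega> in M. (\<Sum>i=2..n. X i \<omega>) = m - k) = neg_binomial \<theta> (R - r 1) (m - k)"
    unfolding R using prob_X
    by (intro sum_neg_binomial \<open>\<theta> > 0\<close> indep_vars_subset[OF indep]) auto
  have S: "S \<omega> = X 1 \<omega> + (\<Sum>i=2..n. X i \<omega>)" for \<omega>
    unfolding assms(10) split by simp
  have "{\<omega>\<in>space M. X 1 \<omega> = k \<and> S \<omega> = m} = {\<omega>\<in>space M. X 1 \<omega> = k \<and> (\<Sum>i=2..n. X i \<omega>) = m - k}"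
    using \<open>k \<le> m\<close> by (auto simp: S)
  then have joint: "\<P>(\<omega> in M. X 1 \<omega> = k \<and> S \<omega> = m) = neg_binomial \<theta> (r 1) k * neg_binomial \<theta> (R - r 1) (m - k)"
    using indep_vars_prob_sum_nat[of "{2..n}" 1 X k "m - k"] indep[unfolded split] prob_X[of 1 k] tail \<open>n \<ge> 2\<close>
    by simp
  \<comment> \<open>The shape R is written as r 1 + (R - r 1) to match
    \<open>neg_binomial_ratio\<close> with a = r 1 and b = R - r 1.\<close>
  have total: "\<P>(\<omega> in M. S \<omega> = m) = neg_binomial \<theta> (r 1 + (R - r 1)) m"
    using sum_neg_binomial[OF \<open>\<theta> > 0\<close> _ indep prob_X, of m] by (simp add: assms(5,10))
  have "r 1 > 0"
    using assms(2,3) by simp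
  from neg_binomial_ratio[OF this R_pos \<open>\<theta> > 0\<close> \<open>k \<le> m\<close>] show ?thesis
    unfolding cond_prob_def joint total by (simp add: algebra_simps)
qed

end
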